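(* Let $e\geq2$ and let $e'\in\{1,\dots,e-1\}$ be a divisor of $e$. Let $\lambda$ be an $e$-core and assume that $\sigma\cdot\alpha(\lambda)=\alpha(\lambda)$. Then $\lambda$ is an $e'$-core.
   Context: A partition is a finite non-increasing sequence $\lambda=(\lambda_1\ge\dots\ge\lambda_h>0)$ of positive integers (possibly empty), with nodes $(a,b)$, $1\le a\le h$, $1\le b\le\lambda_a$. The residue of $(a,b)$ is $b-a\bmod e$; $c_i(\lambda)$ is the number of nodes of residue $i\in\mathbb{Z}/e\mathbb{Z}$. $Q=\bigoplus_{i\in\mathbb{Z}/e\mathbb{Z}}\mathbb{Z}\alpha_i$ is free abelian with basis $(\alpha_i)$, $\alpha(\lambda):=\sum_ic_i(\lambda)\alpha_i$, and $\sigma:Q\to Q$, $\alpha\mapsto\sigma\cdot\alpha$, is the $\mathbb{Z}$-linear map with $\sigma\cdot\alpha_i:=\alpha_{i-e'}$. For $m\ge1$, an $m$-core is a partition with no rim hook of length $m$. *)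

theory Defs
  imports Complex_Main "HOL-Library.Poly_Mapping"
begin

definition is_partition :: "nat list \<Rightarrow> bool" where
  "is_partition lam \<longleftrightarrow> sorted_wrt (\<ge>) lam \<and> (\<forall>x\<in>set lam. 0 < x)"

text \<open>Nodes are indexed from 1, whereas list positions are counted from 0.\<close>

definition nodes :: "nat list \<Rightarrow> (nat \<times> nat) set" where
  "nodes lam = {(a, b). 1 \<le> a \<and> a \<le> length lam \<and> 1 \<le> b \<and> b \<le> lam ! (a - 1)}"

text \<open>The classes of integers modulo \<open>e\<close> are represented by \<open>0, \<dots>, e - 1\<close>.\<close>

definition residue_classes :: "nat \<Rightarrow> int set" where
  "residue_classes e = {0..<int e}"

definition residue :: "nat \<Rightarrow> nat \<times> nat \<Rightarrow> int" where
  "residue e = (\<lambda>(a, b). (int b - int a) mod int e)"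

definition residue_count :: "nat \<Rightarrow> nat list \<Rightarrow> int \<Rightarrow> nat" where
  "residue_count e lam i = card {x \<in> nodes lam. residue e x = i}"

text \<open>The free abelian group on the residue classes modulo \<open>e\<close>, as the subgroup of
  finitely supported functions supported on the canonical representatives.\<close>

definition root_lattice :: "nat \<Rightarrow> (int \<Rightarrow>\<^sub>0 int) set" where
  "root_lattice e = {q. Poly_Mapping.keys q \<subseteq> residue_classes e}"

text \<open>The index of a basis element may be an arbitrary integer; it only matters modulo \<open>e\<close>.\<close>

definition simple_root :: "nat \<Rightarrow> int \<Rightarrow> (int \<Rightarrow>\<^sub>0 int)" where
  "simple_root e i = frag_of (i mod int e)"

definition residue_content :: "nat \<Rightarrow> nat list \<Rightarrow> (int \<Rightarrow>\<^sub>0 int)" where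
  "residue_content e lam =
     (\<Sum>i\<in>residue_classes e. frag_cmul (int (residue_count e lam i)) (simple_root e i))"

definition root_shift :: "nat \<Rightarrow> nat \<Rightarrow> (int \<Rightarrow>\<^sub>0 int) \<Rightarrow> (int \<Rightarrow>\<^sub>0 int)" where
  "root_shift e e' = frag_extend (\<lambda>i. simple_root e (i - int e'))"

lemma root_shift_add: "root_shift e e' (p + q) = root_shift e e' p + root_shift e e' q"
  by (simp add: root_shift_def frag_extend_add)

lemma root_shift_simple_root: "root_shift e e' (simple_root e i) = simple_root e (i - int e')"
  by (simp add: root_shift_def simple_root_def mod_diff_left_eq)

lemma simple_root_in_root_lattice: "0 < e \<Longrightarrow> simple_root e i \<in> root_lattice e"
  by (simp add: simple_root_def root_lattice_def residue_classes_def keys_frag_of)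

lemma residue_content_in_root_lattice: "residue_content e lam \<in> root_lattice e"
proof -
  have "Poly_Mapping.keys (residue_content e lam)
      \<subseteq> (\<Union>i\<in>residue_classes e.
            Poly_Mapping.keys (frag_cmul (int (residue_count e lam i)) (simple_root e i)))"
    unfolding residue_content_def by (rule keys_sum)
  also have "\<dots> \<subseteq> residue_classes e"
    by (auto simp: simple_root_def keys_frag_of residue_classes_def split: if_splits)
  finally show ?thesis by (simp add: root_lattice_def)
qed

lemma root_shift_in_root_lattice: "0 < e \<Longrightarrow> root_shift e e' q \<in> root_lattice e"
proof -
  assume e: "0 < e"
  have "Poly_Mapping.keys (root_shift e e' q)
      \<subseteq> (\<Union>i\<in>Poly_Mapping.keys q. Poly_Mapping.keys (simple_root e (i - int e')))"
    unfolding root_shift_def by (rule keys_frag_extend)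
  also have "\<dots> \<subseteq> residue_classes e"
    using e by (auto simp: simple_root_def keys_frag_of residue_classes_def)
  finally show ?thesis by (simp add: root_lattice_def)
qed

text \<open>The rim of \<open>lam\<close> consists of the nodes \<open>(a, b)\<close> with \<open>(a + 1, b + 1)\<close> not a node.
  The rim hooks are the following segments of the rim, one for each node of \<open>lam\<close>:
  the segment attached to \<open>(a, b)\<close> runs along the rim from the last node of
  column \<open>b\<close> to the last node of row \<open>a\<close>.\<close>

definition rim_hook :: "nat list \<Rightarrow> nat \<times> nat \<Rightarrow> (nat \<times> nat) set" where
  "rim_hook lam = (\<lambda>(a, b). {(a', b') \<in> nodes lam.
      a \<le> a' \<and> b \<le> b' \<and> (a' + 1, b' + 1) \<notin> nodes lam})"

definition is_core :: "nat \<Rightarrow> nat list \<Rightarrow> bool" where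
  "is_core m lam \<longleftrightarrow>
     is_partition lam \<and> \<not> (\<exists>x\<in>nodes lam. card (rim_hook lam x) = m)"

end

theory Submission
  imports Defs
begin

text \<open>
  The proof works on the abacus of the partition. Number the rows from 0, extend \<open>lam\<close> by
  empty rows, and place a bead at the integer \<open>lam\<^sub>k - k\<close> for every row \<open>k\<close>. Two facts about
  this set of beads carry the argument.

  The first, \<open>is_core_iff_beta_set\<close>, says for \<open>m > 0\<close> that a partition is an \<open>m\<close>-core exactly when
  moving any bead down by \<open>m\<close> hits another bead. Indeed a node \<open>(k, j)\<close> determines the bead of
  row \<open>k\<close> and the vacant position coming from column \<open>j\<close>, every vacant position below a bead
  arises in this way, and the rim hook of the node has as many nodes as the distance between the two.

  The second, \<open>runner_counts_shift_invariant\<close>, translates invariance of the content. The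
  contents of row \<open>k\<close> are the integers from \<open>-k\<close> up to just below the bead of the row, so in the
  difference of the number of nodes of residue \<open>i\<close> and of residue \<open>i + 1\<close> each row telescopes
  to its two ends: the difference is the number of beads congruent to \<open>i + 1\<close>, less the
  corresponding number for the empty partition. If the content is invariant under the shift by
  \<open>e'\<close>, the runners of \<open>i\<close> and \<open>i + e'\<close> (the residue classes modulo \<open>e\<close>)
  therefore hold equally many beads above any cutoff \<open>-N\<close>
  with \<open>N\<close> a large enough multiple of \<open>e\<close>.

  Now suppose that \<open>x\<close> is a bead of an \<open>e\<close>-core and \<open>x - e'\<close> is vacant. On each runner
  every position below a bead is a bead. Hence all beads congruent to \<open>x - e'\<close> lie strictly below
  \<open>x - e'\<close>, and raising them by \<open>e'\<close> sends them injectively to beads on the runner of \<open>x\<close>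
  other than \<open>x\<close> itself. The two runners cannot hold equally many beads, a contradiction.
\<close>

section \<open>Beads of a partition\<close>

definition part :: "nat list \<Rightarrow> nat \<Rightarrow> nat" where
  "part lam k = (if k < length lam then lam ! k else 0)"

text \<open>The shift by the row index is not normalised by the number of rows, so that the set of
  beads is infinite below and needs no choice of the number of empty rows.\<close>

definition beta :: "nat list \<Rightarrow> nat \<Rightarrow> int" where
  "beta lam k = int (part lam k) - int k"

abbreviation beta_set :: "nat list \<Rightarrow> int set" where
  "beta_set lam \<equiv> range (beta lam)"

lemma part_antimono: "is_partition lam \<Longrightarrow> k \<le> l \<Longrightarrow> part lam l \<le> part lam k"
  unfolding part_def is_partition_def
  by (cases "k = l") (auto simp: sorted_wrt_iff_nth_less)

lemma beta_strict_antimono: "is_partition lam \<Longrightarrow> k < l \<Longrightarrow> beta lam l < beta lam k"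
  using part_antimono[of lam k l] by (simp add: beta_def)

lemma beta_antimono: "is_partition lam \<Longrightarrow> k \<le> l \<Longrightarrow> beta lam l \<le> beta lam k"
  using part_antimono[of lam k l] by (simp add: beta_def)

lemma inj_beta: "is_partition lam \<Longrightarrow> inj (beta lam)"
  by (rule linorder_injI) (use beta_strict_antimono in force)

lemma Suc_Suc_in_nodes_iff: "(Suc k, Suc j) \<in> nodes lam \<longleftrightarrow> j < part lam k"
  by (auto simp: nodes_def part_def)

lemma nodesE:
  assumes "x \<in> nodes lam"
  obtains k j where "x = (Suc k, Suc j)" "j < part lam k"
proof -
  obtain a b where x: "x = (a, b)" by fastforce
  with assms have "a \<ge> 1" "b \<ge> 1" by (auto simp: nodes_def)
  then obtain k j where "a = Suc k" "b = Suc j"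
    by (metis One_nat_def Suc_le_D)
  with that x assms show thesis by (simp add: Suc_Suc_in_nodes_iff)
qed

section \<open>Rim hooks and vacant positions\<close>

text \<open>Row \<open>t\<close> is the lowest one that meets column \<open>j\<close>, so \<open>j - t\<close> lies strictly between
  the beads of the rows \<open>t\<close> and \<open>t + 1\<close>: it is the vacant position belonging to column \<open>j\<close>.
  The count goes row by row. In a row \<open>i\<close> with \<open>k \<le> i < t\<close> the hook occupies the columns
  from the last one of row \<open>i + 1\<close> to the last one of row \<open>i\<close>, and their number is the distance
  between the beads of these rows; in row \<open>t\<close> it starts at column \<open>j\<close>. The distances telescope.\<close>

lemma card_rim_hook:
  assumes lam: "is_partition lam"
    and kt: "k \<le> t" and above: "j < part lam t" and below: "part lam (Suc t) \<le> j"
  shows "int (card (rim_hook lam (Suc k, Suc j))) = beta lam k - (int j - int t)"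
proof -
  \<comment> \<open>The next row of positive length \<open>l\<close> leaves the columns from \<open>l - 1\<close> on in the rim.
    If it is empty, the truncated subtraction gives \<open>0\<close>, and the whole row lies in the rim.\<close>
  let ?row = "\<lambda>i. {max j (part lam (Suc i) - 1)..<part lam i}"
  have upto_t: "i \<le> t" if "j < part lam i" for i
  proof (rule ccontr)
    assume "\<not> i \<le> t"
    then show False using part_antimono[OF lam, of "Suc t" i] below that by simp
  qed
  have "rim_hook lam (Suc k, Suc j) = map_prod Suc Suc ` (SIGMA i:{k..t}. ?row i)"
  proof (intro set_eqI iffI)
    fix x assume x: "x \<in> rim_hook lam (Suc k, Suc j)"
    then have "x \<in> nodes lam" by (auto simp: rim_hook_def)
    then obtain i l where il: "x = (Suc i, Suc l)" "l < part lam i" by (rule nodesE)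
    with x have "k \<le> i" "j \<le> l" "part lam (Suc i) \<le> Suc l"
      by (auto simp: rim_hook_def Suc_Suc_in_nodes_iff)
    moreover from this il have "i \<le> t" using upto_t by simp
    ultimately show "x \<in> map_prod Suc Suc ` (SIGMA i:{k..t}. ?row i)"
      using il by (intro image_eqI[of _ _ "(i, l)"]) auto
  qed (auto simp: rim_hook_def Suc_Suc_in_nodes_iff)
  then have "card (rim_hook lam (Suc k, Suc j)) = (\<Sum>i=k..t. card (?row i))"
    by (simp add: card_image inj_on_def)
  moreover have "int (\<Sum>i=k..t. card (?row i)) = beta lam k - (int j - int t)"
    using kt
  proof (induction rule: inc_induct)
    case base
    have "max j (part lam (Suc t) - 1) = j" using below by simp
    then show ?case using above by (simp add: beta_def)
  next
    case (step i)
    have "j < part lam (Suc i)" "part lam (Suc i) \<le> part lam i"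
      using part_antimono[OF lam, of "Suc i" t] part_antimono[OF lam, of i "Suc i"] above step.hyps
      by simp_all
    then have "int (card (?row i)) = beta lam i - beta lam (Suc i)"
      by (simp add: beta_def max_def)
    with step show ?case by (simp add: sum.atLeast_Suc_atMost)
  qed
  ultimately show ?thesis by simp
qed

text \<open>Used to find the lowest row that reaches a given column, and the last bead above a given vacant position.\<close>

lemma last_index_obtain:
  fixes P :: "nat \<Rightarrow> bool"
  assumes "P k" and "\<And>i. n \<le> i \<Longrightarrow> \<not> P i"
  obtains t where "k \<le> t" "P t" "\<not> P (Suc t)"
proof -
  have bounded: "i \<le> n" if "P i" for i using assms(2)[of i] that by linarith
  have P: "P (Greatest P)" using assms(1) bounded by (rule GreatestI_nat)
  have "k \<le> Greatest P" using assms(1) bounded by (rule Greatest_le_nat)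
  moreover have "\<not> P (Suc (Greatest P))"
    using Greatest_le_nat[of P "Suc (Greatest P)" n] bounded by auto
  ultimately show thesis using that P by blast
qed

text \<open>From left to right, the vacant position is the one attached to the column of the node.
  From right to left, a vacant position \<open>y\<close> below the bead of row \<open>k\<close> lies between the beads of
  consecutive rows \<open>t\<close> and \<open>t + 1\<close>, and then \<open>y + t\<close> is the column of the required node.\<close>

lemma rim_hook_iff_beta_gap:
  assumes lam: "is_partition lam" and m: "0 < m"
  shows "(\<exists>x\<in>nodes lam. card (rim_hook lam x) = m)
    \<longleftrightarrow> (\<exists>x\<in>beta_set lam. x - int m \<notin> beta_set lam)"
proof
  assume "\<exists>x\<in>nodes lam. card (rim_hook lam x) = m"
  then obtain k j where hook: "card (rim_hook lam (Suc k, Suc j)) = m" and "j < part lam k"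
    by (auto elim: nodesE)
  then obtain t where t: "k \<le> t" "j < part lam t" "part lam (Suc t) \<le> j"
    using last_index_obtain[of "\<lambda>i. j < part lam i" k "length lam"]
    by (auto simp: part_def[of lam "_"] not_less)
  have "beta lam i \<noteq> int j - int t" for i
  proof (cases "i \<le> t")
    case True
    then show ?thesis using beta_antimono[OF lam True] t by (simp add: beta_def)
  next
    case False
    then show ?thesis using beta_antimono[OF lam, of "Suc t" i] t by (simp add: beta_def)
  qed
  then have "int j - int t \<notin> beta_set lam" by (metis rangeE)
  moreover have "beta lam k - int m = int j - int t"
    using card_rim_hook[OF lam t] hook by simp
  ultimately have "beta lam k - int m \<notin> beta_set lam" by simp
  then show "\<exists>x\<in>beta_set lam. x - int m \<notin> beta_set lam" by blast
next
  assume "\<exists>x\<in>beta_set lam. x - int m \<notin> beta_set lam"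
  then obtain k y where y: "y = beta lam k - int m" "y \<notin> beta_set lam" by blast
  obtain t where t: "k \<le> t" "y < beta lam t" "\<not> y < beta lam (Suc t)"
  proof (rule last_index_obtain)
    show "y < beta lam k" using y m by simp
    show "\<not> y < beta lam i" if "length lam + nat (- y) \<le> i" for i
      using that by (simp add: beta_def part_def)
  qed
  then have "beta lam (Suc t) < y" using y by (metis linorder_neqE rangeI)
  then have "y + int t \<ge> int (part lam (Suc t))" by (simp add: beta_def)
  define j where "j = nat (y + int t)"
  have j: "int j = y + int t"
    using \<open>y + int t \<ge> int (part lam (Suc t))\<close> by (simp add: j_def)
  have above: "j < part lam t" using j t(2) by (simp add: beta_def)
  have below: "part lam (Suc t) \<le> j" using j \<open>y + int t \<ge> _\<close> by simp
  have "int (card (rim_hook lam (Suc k, Suc j))) = int m"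
    using card_rim_hook[OF lam t(1) above below] j y by simp
  moreover have "(Suc k, Suc j) \<in> nodes lam"
    using above part_antimono[OF lam t(1)] by (simp add: Suc_Suc_in_nodes_iff)
  ultimately show "\<exists>x\<in>nodes lam. card (rim_hook lam x) = m" by (metis of_nat_eq_iff)
qed

lemma is_core_iff_beta_set:
  "0 < m \<Longrightarrow> is_core m lam \<longleftrightarrow>
    is_partition lam \<and> (\<forall>x\<in>beta_set lam. x - int m \<in> beta_set lam)"
  using rim_hook_iff_beta_gap unfolding is_core_def by blast

section \<open>Residue counts and beads on runners\<close>

lemma residue_count_row_sum:
  assumes "length lam \<le> N"
  shows "residue_count e lam i
    = (\<Sum>k<N. card {j. j < part lam k \<and> (int j - int k) mod int e = i})"
proof -
  let ?row = "\<lambda>k. {j. j < part lam k \<and> (int j - int k) mod int e = i}"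
  have "{x \<in> nodes lam. residue e x = i} = map_prod Suc Suc ` (SIGMA k:{..<N}. ?row k)"
  proof (intro set_eqI iffI)
    fix x assume x: "x \<in> {x \<in> nodes lam. residue e x = i}"
    then obtain k j where kj: "x = (Suc k, Suc j)" "j < part lam k" by (auto elim: nodesE)
    then have "k < N" using assms by (auto simp: part_def split: if_splits)
    then show "x \<in> map_prod Suc Suc ` (SIGMA k:{..<N}. ?row k)"
      using x kj by (intro image_eqI[of _ _ "(k, j)"]) (auto simp: residue_def)
  qed (auto simp: Suc_Suc_in_nodes_iff residue_def)
  then show ?thesis by (simp add: residue_count_def card_image inj_on_def)
qed

lemma mod_eq_add_one_iff: "(x + 1) mod e = (y + 1) mod e \<longleftrightarrow> x mod e = y mod (e::int)"
  by (simp add: mod_eq_dvd_iff)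

text \<open>A node of content \<open>x\<close> contributes \<open>[x + 1 \<equiv> i + 1] - [x \<equiv> i + 1]\<close>, and the contents
  of a row are the consecutive integers from \<open>-k\<close> to \<open>n - k - 1\<close>, so the sum telescopes.\<close>

lemma row_residue_difference:
  fixes e :: int
  shows "int (card {j. j < n \<and> (int j - k) mod e = i mod e})
      - int (card {j. j < n \<and> (int j - k) mod e = (i + 1) mod e})
    = of_bool ((int n - k) mod e = (i + 1) mod e) - of_bool ((- k) mod e = (i + 1) mod e)"
proof (induction n)
  case (Suc n)
  have split: "int (card {j. j < Suc n \<and> P j}) = int (card {j. j < n \<and> P j}) + of_bool (P n)" for P
  proof -
    have "{j. j < Suc n \<and> P j} = (if P n then insert n else id) {j. j < n \<and> P j}"
      by (auto simp: less_Suc_eq)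
    then show ?thesis by simp
  qed
  have "(int (Suc n) - k) mod e = (i + 1) mod e \<longleftrightarrow> (int n - k) mod e = i mod e"
    using mod_eq_add_one_iff[of "int n - k" e i] by (simp add: algebra_simps)
  with Suc show ?case unfolding split by simp
qed simp

lemma residue_count_difference:
  assumes "length lam \<le> N"
  shows "int (residue_count e lam (i mod int e)) - int (residue_count e lam ((i + 1) mod int e))
    = (\<Sum>k<N. of_bool (beta lam k mod int e = (i + 1) mod int e))
      - (\<Sum>k<N. of_bool ((- int k) mod int e = (i + 1) mod int e))"
  unfolding residue_count_row_sum[OF assms] of_nat_sum sum_subtractf[symmetric]
    row_residue_difference beta_def ..

text \<open>The beads of the empty partition above a cutoff that is a multiple of \<open>e\<close> are equally
  distributed over the runners: one step of the shift moves the window of \<open>e * l\<close>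
  consecutive integers by one, which exchanges two congruent end points.\<close>

lemma empty_runner_shift:
  fixes e l d :: nat
  shows "(\<Sum>k<e * l. of_bool ((- int k) mod int e = (i + int d) mod int e) :: int)
    = (\<Sum>k<e * l. of_bool ((- int k) mod int e = i mod int e))"
proof (induction d)
  case (Suc d)
  let ?f = "\<lambda>k. of_bool ((- int k) mod int e = (i + int d) mod int e) :: int"
  have "(- int k) mod int e = (i + int (Suc d)) mod int e
      \<longleftrightarrow> (- int (Suc k)) mod int e = (i + int d) mod int e" for k
    using mod_eq_add_one_iff[of "- int (Suc k)" "int e" "i + int d"] by (simp add: algebra_simps)
  then have "(\<Sum>k<e * l. of_bool ((- int k) mod int e = (i + int (Suc d)) mod int e))
      - (\<Sum>k<e * l. ?f k) = (\<Sum>k<e * l. ?f (Suc k) - ?f k)"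
    by (simp add: sum_subtractf)
  also have "\<dots> = ?f (e * l) - ?f 0" by (rule sum_lessThan_telescope)
  also have "\<dots> = 0" by (simp add: mod_minus_eq[of "int e * int l", symmetric])
  finally show ?case using Suc by simp
qed simp

text \<open>The shift sends \<open>\<alpha>\<^sub>j\<close> to \<open>\<alpha>\<^bsub>j - d\<^esub>\<close>, so the coefficient at \<open>i\<close> of
  the shifted content is the count of residue \<open>i + d\<close>. The lookup is computed for an arbitrary
  shift \<open>r\<close> so that it serves both for \<open>r = d\<close> and for the content itself, where \<open>r = 0\<close>.\<close>

lemma residue_count_shift_invariant:
  assumes e: "0 < e"
    and inv: "root_shift e d (residue_content e lam) = residue_content e lam"
  shows "residue_count e lam ((i + int d) mod int e) = residue_count e lam (i mod int e)"
proof -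
  let ?c = "\<lambda>j. int (residue_count e lam j)"
  have lookup: "Poly_Mapping.lookup
      (\<Sum>j\<in>residue_classes e. frag_cmul (?c j) (simple_root e (j - r))) (i mod int e)
      = ?c ((i + r) mod int e)" for r
  proof -
    have shifted: "(j - r) mod int e = i mod int e \<longleftrightarrow> j = (i + r) mod int e"
      if "j \<in> residue_classes e" for j
    proof -
      have "(j - r) mod int e = i mod int e \<longleftrightarrow> j mod int e = (i + r) mod int e"
        by (simp add: mod_eq_dvd_iff algebra_simps)
      with that show ?thesis by (simp add: residue_classes_def)
    qed
    have "?c j * Poly_Mapping.lookup (simple_root e (j - r)) (i mod int e)
        = (if j = (i + r) mod int e then ?c j else 0)"
      if "j \<in> residue_classes e" for j
      using that shifted[OF that]
      unfolding simple_root_def lookup_frag_of by auto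
    then have "Poly_Mapping.lookup
      (\<Sum>j\<in>residue_classes e. frag_cmul (?c j) (simple_root e (j - r))) (i mod int e)
      = (\<Sum>j\<in>residue_classes e. if j = (i + r) mod int e then ?c j else 0)"
      by (simp add: lookup_sum)
    also have "\<dots> = ?c ((i + r) mod int e)"
      using e by (simp add: residue_classes_def)
    finally show ?thesis .
  qed
  have "root_shift e d (residue_content e lam)
      = (\<Sum>j\<in>residue_classes e. frag_cmul (?c j) (root_shift e d (simple_root e j)))"
    by (simp add: residue_content_def root_shift_def frag_extend_sum frag_extend_cmul
        residue_classes_def o_def)
  then have "(\<Sum>j\<in>residue_classes e. frag_cmul (?c j) (simple_root e (j - int d)))
      = (\<Sum>j\<in>residue_classes e. frag_cmul (?c j) (simple_root e (j - 0)))"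
    using inv by (simp add: root_shift_simple_root residue_content_def)
  then have "?c ((i + int d) mod int e) = ?c ((i + 0) mod int e)"
    using lookup by metis
  then show ?thesis by simp
qed

text \<open>Both differences of consecutive residue counts agree, and so do the terms for the
  empty partition because the number of rows taken into account is a multiple of \<open>e\<close>.\<close>

lemma runner_counts_shift_invariant:
  fixes e l d :: nat
  assumes e: "0 < e" and N: "length lam \<le> e * l"
    and inv: "root_shift e d (residue_content e lam) = residue_content e lam"
  shows "card {k. k < e * l \<and> beta lam k mod int e = (i + int d) mod int e}
    = card {k. k < e * l \<and> beta lam k mod int e = i mod int e}"
proof -
  let ?runner = "\<lambda>i. \<Sum>k<e * l. of_bool (beta lam k mod int e = i mod int e) :: int"
  have "?runner (i - 1 + int d + 1) - ?runner (i - 1 + 1) = 0"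
    using residue_count_difference[OF N, of e "i - 1 + int d"]
      residue_count_difference[OF N, of e "i - 1"]
      residue_count_shift_invariant[OF e inv, of "i - 1"]
      residue_count_shift_invariant[OF e inv, of i]
      empty_runner_shift[of e i d l]
    by (simp add: algebra_simps)
  then have "?runner (i + int d) = ?runner i" by (simp add: algebra_simps)
  then show ?thesis by (simp add: of_bool_def sum.If_cases Collect_conj_eq lessThan_def)
qed

text \<open>Beyond the last row the beads occupy every position, so cutting off the rows from \<open>N\<close>
  on is the same as cutting off the positions up to \<open>-N\<close>.\<close>

lemma cutoff_less_beta_iff:
  assumes "length lam \<le> N"
  shows "- int N < beta lam k \<longleftrightarrow> k < N"
  using assms by (auto simp: beta_def part_def)

section \<open>Cores with shift-invariant content\<close>

theorem proposition4p14:
  fixes e e' :: nat and lam :: "nat list"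
  assumes "e \<ge> 2"
    and "e' \<in> {1..e - 1}"
    and "e' dvd e"
    and "is_core e lam"
    and "root_shift e e' (residue_content e lam) = residue_content e lam"
  shows "is_core e' lam"
proof -
  have e: "0 < e" and e': "0 < e'" using assms(1,2) by auto
  have lam: "is_partition lam" and closed: "\<And>x. x \<in> beta_set lam \<Longrightarrow> x - int e \<in> beta_set lam"
    using assms(4) is_core_iff_beta_set[OF e] by auto
  \<comment> \<open>On each runner the beads form an initial segment.\<close>
  have closed_down: "w \<in> beta_set lam"
    if "z \<in> beta_set lam" "w mod int e = z mod int e" "w \<le> z" for z w
  proof -
    have "int e dvd z - w" using that(2)[symmetric] by (simp add: mod_eq_dvd_iff)
    then obtain q where q: "z - w = int e * q" by (rule dvdE)
    with that(3) have "0 \<le> int e * q" by linarith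
    with e have "0 \<le> q" by (simp add: zero_le_mult_iff)
    then obtain n where "q = int n" by (rule nonneg_int_cases)
    with q have w: "w = z - int e * int n" by simp
    have "z - int e * int n \<in> beta_set lam" for n
    proof (induction n)
      case (Suc n)
      then show ?case using closed[OF Suc] by (simp add: algebra_simps)
    qed (use that(1) in simp)
    with w show ?thesis by simp
  qed
  have "x - int e' \<in> beta_set lam" if x: "x \<in> beta_set lam" for x
  proof (rule ccontr)
    assume gap: "x - int e' \<notin> beta_set lam"
    let ?N = "e * length lam"
    have N: "length lam \<le> ?N" using e by simp
    let ?runner = "\<lambda>i. {k. k < ?N \<and> beta lam k mod int e = i mod int e}"
    have "inj_on (\<lambda>k. beta lam k + int e') (?runner (x - int e'))"
      using inj_beta[OF lam] by (auto simp: inj_on_def)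
    \<comment> \<open>Beads congruent to the vacant position lie below it, so raising them stays below \<open>x\<close>.\<close>
    moreover have "(\<lambda>k. beta lam k + int e') ` ?runner (x - int e')
        \<subseteq> beta lam ` ?runner x - {x}"
    proof (rule image_subsetI)
      fix k assume k: "k \<in> ?runner (x - int e')"
      then have less: "beta lam k < x - int e'"
        using gap closed_down[of "beta lam k" "x - int e'"] by force
      have cong: "(beta lam k + int e') mod int e = x mod int e"
        using k by (simp add: mod_eq_dvd_iff algebra_simps)
      with less have "beta lam k + int e' \<in> beta_set lam"
        using closed_down[OF x] by simp
      then obtain k' where k': "beta lam k + int e' = beta lam k'" by blast
      have "- int ?N < beta lam k" using k cutoff_less_beta_iff[OF N, of k] by simp
      then have "- int ?N < beta lam k'" using k' by linarith
      then have "k' < ?N" using cutoff_less_beta_iff[OF N] by blast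
      with k' cong less show "beta lam k + int e' \<in> beta lam ` ?runner x - {x}" by auto
    qed
    ultimately have "card (?runner (x - int e')) \<le> card (beta lam ` ?runner x - {x})"
      by (intro card_inj_on_le) auto
    also have "\<dots> < card (beta lam ` ?runner x)"
    proof (rule card_Diff1_less)
      obtain k where k: "x = beta lam k" using x by blast
      have "k < length lam"
      proof (rule ccontr)
        assume "\<not> k < length lam"
        then have "x - int e' = beta lam (k + e')" using k by (simp add: beta_def part_def)
        with gap show False by blast
      qed
      with N have "k < ?N" by linarith
      with k show "x \<in> beta lam ` ?runner x" by simp
    qed simp
    also have "card (beta lam ` ?runner x) \<le> card (?runner x)" by (simp add: card_image_le)
    finally show False
      using runner_counts_shift_invariant[OF e N assms(5), of "x - int e'"] by simp
  qed
  with lam show ?thesis by (simp add: is_core_iff_beta_set[OF e'])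
qed

end
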